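(* Let $q,d,r$ be positive integers with $1\leq q<d$, let $\Phi=(\varphi_1,\ldots,\varphi_q)$ be a $q$-tuple of functions in $H^\infty(\mathbb D^d)$, and let $F=(f_1,\ldots,f_r)$ be an $r$-tuple of functions in $H^2(\mathbb D^d)$. Set $$\mathcal M_\Phi(F)=\overline{\operatorname{span}}\{\varphi_1^{\alpha_1}\cdots\varphi_q^{\alpha_q}f_j:\alpha\in\mathbb N_0^q,\ 1\leq j\leq r\},$$ the closure being taken in the norm of $H^2(\mathbb D^d)$. Then $\mathcal M_\Phi(F)$ has infinite codimension in $H^2(\mathbb D^d)$, i.e. the quotient $H^2(\mathbb D^d)/\mathcal M_\Phi(F)$ is infinite-dimensional.
   Context: $\mathbb D\subset\mathbb C$ is the open unit disk, $\mathbb D^d$ is the polydisk, and $\mathbb N_0=\{0,1,2,\ldots\}$. The Hardy space $H^2(\mathbb D^d)$ is the Hilbert space of holomorphic functions $f(z)=\sum_{\alpha\in\mathbb N_0^d}a_\alpha z^\alpha$ on $\mathbb D^d$ with $\|f\|^2=\sum_\alpha|a_\alpha|^2<\infty$, where $z^\alpha=z_1^{\alpha_1}\cdots z_d^{\alpha_d}$. $H^\infty(\mathbb D^d)$ is the algebra of bounded holomorphic functions on $\mathbb D^d$. *)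

theory Defs
  imports
    "HOL-Analysis.Analysis"
    "HOL-Library.Function_Algebras"
    "HOL-Library.Set_Algebras"
begin

definition polydisk :: "(complex ^ 'd) set" where
  "polydisk = {z. \<forall>i. cmod (z $ i) < 1}"

text \<open>Holomorphy in several variables: Frechet differentiability with a complex-linear
  derivative. To be used for open sets only.\<close>

definition mv_holomorphic_on :: "(complex ^ 'd \<Rightarrow> complex) \<Rightarrow> (complex ^ 'd) set \<Rightarrow> bool"
    (infixl "mv'_holomorphic'_on" 50) where
  "f mv_holomorphic_on S \<longleftrightarrow>
     (\<forall>z\<in>S. \<exists>D. (f has_derivative D) (at z) \<and> (\<forall>c v. D (c *s v) = c * D v))"

definition mono_power :: "complex ^ 'd \<Rightarrow> ('d \<Rightarrow> nat) \<Rightarrow> complex" where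
  "mono_power z \<alpha> = (\<Prod>i\<in>UNIV. (z $ i) ^ \<alpha> i)"

definition has_power_series :: "(complex ^ 'd \<Rightarrow> complex) \<Rightarrow> (('d \<Rightarrow> nat) \<Rightarrow> complex) \<Rightarrow> bool" where
  "has_power_series f a \<longleftrightarrow>
     (\<forall>z\<in>polydisk. ((\<lambda>\<alpha>. a \<alpha> * mono_power z \<alpha>) has_sum f z) UNIV)"

text \<open>A function on the polydisk is encoded as a total function vanishing outside the polydisk, so
  that equality of functions on the polydisk is equality in HOL.\<close>

definition hardy2 :: "(complex ^ 'd \<Rightarrow> complex) set" where
  "hardy2 = {f. f mv_holomorphic_on polydisk \<and> (\<forall>z. z \<notin> polydisk \<longrightarrow> f z = 0) \<and>
     (\<exists>a. has_power_series f a \<and> (\<lambda>\<alpha>. (cmod (a \<alpha>))\<^sup>2) summable_on UNIV)}"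

text \<open>The coefficients of a convergent power series are uniquely determined by its sum.\<close>

definition hardy_coeff :: "(complex ^ 'd \<Rightarrow> complex) \<Rightarrow> ('d \<Rightarrow> nat) \<Rightarrow> complex" where
  "hardy_coeff f = (THE a. has_power_series f a)"

definition hardy_norm :: "(complex ^ 'd \<Rightarrow> complex) \<Rightarrow> real" where
  "hardy_norm f = sqrt (\<Sum>\<^sub>\<infinity>\<alpha>. (cmod (hardy_coeff f \<alpha>))\<^sup>2)"

text \<open>Elements of this set only serve as multipliers of functions vanishing outside the polydisk,
  so their values there are left unconstrained.\<close>

definition hardy_inf :: "(complex ^ 'd \<Rightarrow> complex) set" where
  "hardy_inf = {f. f mv_holomorphic_on polydisk \<and> bounded (f ` polydisk)}"

definition cscale :: "complex \<Rightarrow> ('a \<Rightarrow> complex) \<Rightarrow> 'a \<Rightarrow> complex" where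
  "cscale c f = (\<lambda>x. c * f x)"

interpretation cfun: vector_space "cscale :: complex \<Rightarrow> ('a \<Rightarrow> complex) \<Rightarrow> 'a \<Rightarrow> complex"
  by unfold_locales (auto simp: cscale_def algebra_simps)

text \<open>The closure is relative to the space \<open>hardy2\<close>, so points of \<open>S\<close> outside it are ignored, as
  with \<open>closure_of\<close>. There are none when \<open>S\<close> is the span in \<open>hardy_module\<close>, because bounded
  holomorphic functions multiply \<open>hardy2\<close> into itself.\<close>

definition hardy_closure :: "(complex ^ 'd \<Rightarrow> complex) set \<Rightarrow> (complex ^ 'd \<Rightarrow> complex) set" where
  "hardy_closure S = {g \<in> hardy2. \<forall>\<epsilon>>0. \<exists>h \<in> S \<inter> hardy2. hardy_norm (g - h) < \<epsilon>}"

definition hardy_module ::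
    "nat \<Rightarrow> nat \<Rightarrow> (nat \<Rightarrow> complex ^ 'd \<Rightarrow> complex) \<Rightarrow> (nat \<Rightarrow> complex ^ 'd \<Rightarrow> complex)
      \<Rightarrow> (complex ^ 'd \<Rightarrow> complex) set" where
  "hardy_module q r \<phi> f = hardy_closure (cfun.span
     {(\<lambda>z. (\<Prod>i=1..q. \<phi> i z ^ \<alpha> i) * f j z) | (\<alpha> :: nat \<Rightarrow> nat) j. j \<in> {1..r}})"

text \<open>The quotient of a space of functions \<open>V\<close> by a subspace \<open>M\<close>, as a set of cosets. Addition of
  cosets is addition of sets, with \<open>M\<close> as zero; adding \<open>M\<close> in \<open>coset_scale\<close> only matters
  for the scalar \<open>0\<close>, and in \<open>coset_span\<close> only for the empty sum.\<close>

definition quotient_space :: "('a \<Rightarrow> complex) set \<Rightarrow> ('a \<Rightarrow> complex) set \<Rightarrow> ('a \<Rightarrow> complex) set set" where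
  "quotient_space V M = (\<lambda>f. f +o M) ` V"

definition coset_scale :: "('a \<Rightarrow> complex) set \<Rightarrow> complex \<Rightarrow> ('a \<Rightarrow> complex) set \<Rightarrow> ('a \<Rightarrow> complex) set" where
  "coset_scale M c X = cscale c ` X + M"

definition coset_span :: "('a \<Rightarrow> complex) set \<Rightarrow> ('a \<Rightarrow> complex) set set \<Rightarrow> ('a \<Rightarrow> complex) set set" where
  "coset_span M B = {(\<Sum>X\<in>B. coset_scale M (c X) X) + M | c. True}"

definition infinite_codim :: "('a \<Rightarrow> complex) set \<Rightarrow> ('a \<Rightarrow> complex) set \<Rightarrow> bool" where
  "infinite_codim V M \<longleftrightarrow>
     \<not> (\<exists>B. finite B \<and> B \<subseteq> quotient_space V M \<and> quotient_space V M = coset_span M B)"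

end

theory Submission
  imports Defs "HOL-Library.Landau_Symbols"
begin

text \<open>
  The proof compares the growth of two dimensions at the origin. The Taylor coefficients of
  degree at most \<open>n\<close> of functions in \<open>hardy2\<close> can be prescribed freely, so they form a space whose
  dimension grows like \<open>n ^ d\<close> with \<open>d = CARD('d)\<close>. The module only reaches a subspace of dimension
  \<open>O(n ^ q)\<close>: its algebraic span does not change when each \<open>\<phi> i\<close> is replaced by \<open>\<phi> i - \<phi> i 0\<close>, a
  product of more than \<open>n\<close> of these differences is \<open>O(norm z ^ Suc n)\<close>, and there are only \<open>O(n ^ q)\<close>
  shorter products (\<open>module_generators_modulo_vanishing_order\<close>). Taylor coefficients are continuous
  functionals on \<open>hardy2\<close>, so the closure does not enlarge the subspace. As \<open>q < d\<close>, the codimension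
  exceeds every bound.

  To avoid quotient spaces and the closedness of finite-dimensional subspaces, the comparison is
  phrased by one functional \<open>\<Lambda>\<close>, a linear combination of Taylor coefficients. Were the quotient
  spanned by \<open>m\<close> cosets, then the requirement that \<open>\<Lambda>\<close> kills the module and \<open>m\<close> representatives
  would be a homogeneous linear system with fewer equations than unknowns, so some nonzero \<open>\<Lambda>\<close>
  would vanish on all of \<open>hardy2\<close>; but on monomials it takes its own coefficients as values.

  The approximation by short products takes place among arbitrary functions modulo
  \<open>O(norm z ^ Suc n)\<close>, without Taylor expansions of the products \<open>\<phi>\<^sup>\<alpha> f\<close> and without knowing
  that these lie in \<open>hardy2\<close>. The lemma \<open>subspace_Int_span_Un_le\<close> leads back to \<open>hardy2\<close>, and
  \<open>low_coeffs_of_vanishing_series\<close> shows that the error term has no Taylor coefficients of degree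
  at most \<open>n\<close>.
\<close>

section \<open>Linear algebra\<close>

text \<open>Gaussian elimination: solving one equation for an unknown \<open>p\<close> with nonzero coefficient removes
  one equation and one unknown, so the surplus of unknowns persists.\<close>

lemma homogeneous_system_nontrivial_solution:
  fixes A :: "'e \<Rightarrow> 'i \<Rightarrow> 'k :: field"
  assumes "finite E" "finite I" "card E < card I"
  shows "\<exists>x. (\<exists>i\<in>I. x i \<noteq> 0) \<and> (\<forall>e\<in>E. (\<Sum>i\<in>I. A e i * x i) = 0)"
  using assms
proof (induction E arbitrary: I A rule: finite_induct)
  case empty
  then obtain i where "i \<in> I" by fastforce
  then show ?case by (intro exI[of _ "\<lambda>_. 1"]) auto
next
  case (insert e E)
  show ?case
  proof (cases "\<forall>i\<in>I. A e i = 0")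
    case True
    have "card E < card I" using insert by simp
    from insert.IH[OF insert.prems(1) this, of A] True show ?thesis by auto
  next
    case False
    then obtain p where p: "p \<in> I" "A e p \<noteq> 0" by auto
    define I' where "I' = I - {p}"
    define A' where "A' = (\<lambda>e' i. A e' i - A e' p * A e i / A e p)"
    have I: "I = insert p I'" "p \<notin> I'" "finite I'" using p insert.prems by (auto simp: I'_def)
    have "card E < card I'" using insert I by simp
    from insert.IH[OF I(3) this, of A'] obtain x where
      x: "\<exists>i\<in>I'. x i \<noteq> 0" "\<And>e'. e' \<in> E \<Longrightarrow> (\<Sum>i\<in>I'. A' e' i * x i) = 0" by blast
    define s where "s = (\<Sum>i\<in>I'. A e i * x i)"
    define y where "y = x(p := - s / A e p)"
    have y: "(\<Sum>i\<in>I. A e' i * y i) = (\<Sum>i\<in>I'. A e' i * x i) - A e' p * s / A e p" for e'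
    proof -
      have "(\<Sum>i\<in>I'. A e' i * y i) = (\<Sum>i\<in>I'. A e' i * x i)"
        using I by (intro sum.cong) (auto simp: y_def)
      then show ?thesis using I by (simp add: y_def)
    qed
    have "(\<Sum>i\<in>I. A e' i * y i) = 0" if "e' \<in> E" for e'
    proof -
      have "A e' p * s / A e p = (\<Sum>i\<in>I'. A e' p * A e i / A e p * x i)"
        by (simp add: s_def sum_distrib_left sum_divide_distrib mult.assoc)
      then have "(\<Sum>i\<in>I'. A e' i * x i) - A e' p * s / A e p = (\<Sum>i\<in>I'. A' e' i * x i)"
        by (simp add: A'_def left_diff_distrib sum_subtractf)
      then show ?thesis using x(2)[OF that] y by simp
    qed
    moreover have "(\<Sum>i\<in>I. A e i * y i) = 0"
      using p by (simp add: y s_def)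
    moreover have "\<exists>i\<in>I. y i \<noteq> 0" using x(1) I by (auto simp: y_def)
    ultimately show ?thesis by blast
  qed
qed

text \<open>The elements of \<open>V\<close> that are combinations of \<open>U\<close> modulo \<open>span Z\<close> need no more generators than \<open>U\<close>
  has, even if these are required to come from \<open>V\<close> itself. By the exchange lemma, each \<open>u \<in> U\<close> that
  contributes anything new to \<open>V\<close> can be traded for an element of \<open>V\<close>.\<close>

lemma (in vector_space) subspace_Int_span_Un_le:
  assumes "subspace V" "finite U"
  shows "\<exists>W\<subseteq>V. finite W \<and> card W \<le> card U \<and> V \<inter> span (U \<union> Z) \<subseteq> span (W \<union> Z)"
  using assms(2)
proof (induction U rule: finite_induct)
  case empty
  then show ?case by (intro exI[of _ "{}"]) auto
next
  case (insert u U)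
  then obtain W where W: "W \<subseteq> V" "finite W" "card W \<le> card U"
    "V \<inter> span (U \<union> Z) \<subseteq> span (W \<union> Z)" by blast
  show ?case
  proof (cases "V \<inter> span (insert u U \<union> Z) \<subseteq> span (U \<union> Z)")
    case True
    then show ?thesis using W insert by (intro exI[of _ W]) auto
  next
    case False
    then obtain w where w: "w \<in> V" "w \<in> span (insert u (U \<union> Z))" "w \<notin> span (U \<union> Z)" by auto
    have "u \<in> span (insert w (U \<union> Z))" using in_span_insert[OF w(2,3)] .
    then have sub: "span (insert u (U \<union> Z)) \<subseteq> span (insert w (U \<union> Z))"
      by (intro span_minimal) (auto simp: span_base)
    have "v \<in> span (insert w W \<union> Z)" if v: "v \<in> V" "v \<in> span (insert u (U \<union> Z))" for v
    proof -
      have "v \<in> span (insert w (U \<union> Z))" using v(2) sub by blast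
      then obtain k where k: "v - scale k w \<in> span (U \<union> Z)"
        by (auto simp: span_breakdown_eq)
      have "v - scale k w \<in> V"
        using v w assms(1) by (intro subspace_diff subspace_scale)
      then have "v - scale k w \<in> span (W \<union> Z)" using k W by blast
      then show ?thesis by (auto simp: span_breakdown_eq)
    qed
    moreover have "card (insert w W) \<le> card (insert u U)"
      using W insert by (simp add: card_insert_if)
    ultimately show ?thesis using W w by (intro exI[of _ "insert w W"]) auto
  qed
qed

text \<open>Finite codimension in terms of subspaces instead of cosets: \<open>W\<close> consists of one representative of
  each coset in a finite spanning set. Testing against subspaces \<open>P\<close>, which will be kernels of
  functionals, spares the computation with sums of cosets.\<close>

lemma not_infinite_codim_imp_finitely_generated:
  assumes "\<not> infinite_codim V M" "0 \<in> M"
  shows "\<exists>W\<subseteq>V. finite W \<and> (\<forall>P. cfun.subspace P \<longrightarrow> M \<subseteq> P \<longrightarrow> W \<subseteq> P \<longrightarrow> V \<subseteq> P)"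
proof -
  from assms obtain B where B: "finite B" "B \<subseteq> quotient_space V M"
    "quotient_space V M = coset_span M B" by (auto simp: infinite_codim_def)
  have "\<exists>v\<in>V. X = v +o M" if "X \<in> B" for X
    using B(2) that by (auto simp: quotient_space_def)
  then obtain v where v: "\<And>X. X \<in> B \<Longrightarrow> v X \<in> V" "\<And>X. X \<in> B \<Longrightarrow> X = v X +o M" by metis
  have "V \<subseteq> P" if P: "cfun.subspace P" "M \<subseteq> P" "v ` B \<subseteq> P" for P
  proof
    fix g assume "g \<in> V"
    have plus: "S + T \<subseteq> P" if "S \<subseteq> P" "T \<subseteq> P" for S T
      using that P(1) by (auto simp: set_plus_def intro!: cfun.subspace_add)
    have X: "X \<subseteq> P" if "X \<in> B" for X
    proof -
      have "v X +o M \<subseteq> P"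
        using that P by (auto simp: elt_set_plus_def intro!: cfun.subspace_add)
      then show ?thesis using v(2)[OF that] by simp
    qed
    have scale: "coset_scale M c X \<subseteq> P" if "X \<in> B" for c X
      unfolding coset_scale_def using X[OF that] P by (intro plus) (auto intro: cfun.subspace_scale)
    have sum: "(\<Sum>X\<in>C. coset_scale M (c X) X) \<subseteq> P" if "C \<subseteq> B" for C c
      using finite_subset[OF that B(1)] that
    proof (induction C rule: finite_induct)
      case empty
      then show ?case using cfun.subspace_0[OF P(1)] by (simp add: set_zero)
    next
      case (insert X C)
      then have "coset_scale M (c X) X + (\<Sum>X\<in>C. coset_scale M (c X) X) \<subseteq> P"
        by (intro plus scale) auto
      then show ?case using insert.hyps by simp
    qed
    have "g +o M \<in> coset_span M B" using \<open>g \<in> V\<close> B(3) by (auto simp: quotient_space_def)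
    then have "g +o M \<subseteq> P" unfolding coset_span_def using plus[OF sum P(2)] by auto
    moreover have "g \<in> g +o M" using assms(2) by (force simp: elt_set_plus_def)
    ultimately show "g \<in> P" by auto
  qed
  then show ?thesis using v(1) B(1) by (intro exI[of _ "v ` B"]) auto
qed

section \<open>Functions vanishing to a given order at the origin\<close>

text \<open>Only the growth near the origin counts. Holomorphy is not part of the notion, so that it can be
  applied to the factors of a product separately and to functions known only up to an error term.\<close>

definition vanishing_order :: "nat \<Rightarrow> (complex ^ 'd \<Rightarrow> complex) set" where
  "vanishing_order n = O[at 0](\<lambda>z. of_real (norm z ^ n))"

lemma subspace_vanishing_order: "cfun.subspace (vanishing_order n)"
  unfolding cfun.subspace_def
proof (intro conjI ballI allI)
  show "0 \<in> vanishing_order n"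
    by (simp add: vanishing_order_def zero_fun_def)
  show "g + h \<in> vanishing_order n" if "g \<in> vanishing_order n" "h \<in> vanishing_order n" for g h
    using sum_in_bigo(1)[OF that[unfolded vanishing_order_def]]
    by (simp add: vanishing_order_def plus_fun_def)
  show "cscale c h \<in> vanishing_order n" if "h \<in> vanishing_order n" for c h
    using that
    by (cases "c = 0") (auto simp: vanishing_order_def cscale_def)
qed

lemma vanishing_order_mult:
  assumes "g \<in> vanishing_order m" "h \<in> vanishing_order n"
  shows "(\<lambda>z. g z * h z) \<in> vanishing_order (m + n)"
  using landau_o.big.mult[OF assms[unfolded vanishing_order_def]]
  by (simp add: vanishing_order_def power_add)

lemma vanishing_order_power:
  assumes "g \<in> vanishing_order m"
  shows "(\<lambda>z. g z ^ k) \<in> vanishing_order (k * m)"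
proof (induction k)
  case 0
  then show ?case by (simp add: vanishing_order_def)
next
  case (Suc k)
  then show ?case using vanishing_order_mult[OF assms Suc] by simp
qed

lemma vanishing_order_prod_power:
  assumes "finite I" "\<And>i. i \<in> I \<Longrightarrow> \<psi> i \<in> vanishing_order 1"
  shows "(\<lambda>z. \<Prod>i\<in>I. \<psi> i z ^ \<gamma> i) \<in> vanishing_order (\<Sum>i\<in>I. \<gamma> i)"
  using assms
proof (induction I rule: finite_induct)
  case empty
  then show ?case by (simp add: vanishing_order_def)
next
  case (insert i I)
  have "(\<lambda>z. \<psi> i z ^ \<gamma> i) \<in> vanishing_order (\<gamma> i)"
    using vanishing_order_power[of "\<psi> i" 1 "\<gamma> i"] insert.prems by simp
  moreover have "(\<lambda>z. \<Prod>i\<in>I. \<psi> i z ^ \<gamma> i) \<in> vanishing_order (\<Sum>i\<in>I. \<gamma> i)"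
    using insert by auto
  ultimately show ?case using vanishing_order_mult insert.hyps by fastforce
qed

lemma vanishing_order_antimono:
  assumes "m \<le> n"
  shows "vanishing_order n \<subseteq> (vanishing_order m :: (complex ^ 'd \<Rightarrow> complex) set)"
proof -
  have "(\<lambda>z :: complex ^ 'd. of_real (norm z ^ n) :: complex) \<in> O[at 0](\<lambda>z. of_real (norm z ^ m))"
  proof (rule bigoI[of _ 1])
    have "\<forall>\<^sub>F z :: complex ^ 'd in at 0. norm z < 1"
      using eventually_at_ball[of 1 "0 :: complex ^ 'd" UNIV]
      by (simp add: eventually_at_filter)
    then show "\<forall>\<^sub>F z :: complex ^ 'd in at 0. norm (of_real (norm z ^ n) :: complex)
        \<le> 1 * norm (of_real (norm z ^ m) :: complex)"
      by eventually_elim (use assms in \<open>simp add: norm_power power_decreasing\<close>)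
  qed
  then show ?thesis unfolding vanishing_order_def using landau_o.big_trans by blast
qed

lemma zero_in_polydisk [simp]: "0 \<in> polydisk"
  by (simp add: polydisk_def)

lemma mv_holomorphic_on_imp_vanishing_order_0:
  assumes "f mv_holomorphic_on polydisk"
  shows "f \<in> vanishing_order 0"
proof -
  obtain D where "(f has_derivative D) (at 0)"
    using assms by (auto simp: mv_holomorphic_on_def dest: bspec[OF _ zero_in_polydisk])
  then have "(f \<longlongrightarrow> f 0) (at 0)"
    using has_derivative_continuous isContD by blast
  then have "f \<in> O[at 0](\<lambda>_. 1)" by (intro bigoI_tendsto[of _ _ "f 0"]) auto
  then show ?thesis by (simp add: vanishing_order_def)
qed

lemma mv_holomorphic_on_imp_vanishing_order_1:
  assumes "f mv_holomorphic_on polydisk"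
  shows "(\<lambda>z. f z - f 0) \<in> vanishing_order 1"
proof -
  obtain D where D: "(f has_derivative D) (at 0)"
    using assms by (auto simp: mv_holomorphic_on_def dest: bspec[OF _ zero_in_polydisk])
  obtain K where K: "\<And>z. norm (D z) \<le> norm z * K"
    using bounded_linear.bounded[OF has_derivative_bounded_linear[OF D]] by blast
  from D have "((\<lambda>y. norm (f y - f 0 - D y) / norm y) \<longlongrightarrow> 0) (at 0)"
    by (simp add: has_derivative_iff_norm)
  then have "\<forall>\<^sub>F y in at 0. norm (f y - f 0 - D y) / norm y < 1"
    by (rule order_tendstoD) simp
  then have "\<forall>\<^sub>F y in at 0. norm (f y - f 0) \<le> (K + 1) * norm (of_real (norm y ^ 1) :: complex)"
    using eventually_at_filter[of "\<lambda>y. y \<noteq> 0" 0 UNIV, simplified]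
  proof eventually_elim
    case (elim y)
    then have "norm (f y - f 0 - D y) < norm y" by (simp add: divide_simps split: if_splits)
    moreover have "norm (f y - f 0) \<le> norm (f y - f 0 - D y) + norm (D y)"
      by (metis diff_add_cancel norm_triangle_ineq)
    ultimately show ?case using K[of y] by (simp add: algebra_simps)
  qed
  then show ?thesis unfolding vanishing_order_def by (rule bigoI)
qed

section \<open>Power series vanishing to a given order\<close>

text \<open>The weights are the powers of \<open>Suc n\<close>: a number is determined by its digits in base \<open>Suc n\<close>.\<close>

lemma digit_weights:
  assumes "finite A"
  shows "\<exists>\<epsilon> :: 'a \<Rightarrow> nat. \<forall>\<beta> \<gamma>. (\<forall>i\<in>A. \<beta> i \<le> n) \<longrightarrow> (\<forall>i\<in>A. \<gamma> i \<le> n) \<longrightarrow>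
    (\<Sum>i\<in>A. \<epsilon> i * \<beta> i) = (\<Sum>i\<in>A. \<epsilon> i * \<gamma> i) \<longrightarrow> (\<forall>i\<in>A. \<beta> i = \<gamma> i)"
  using assms
proof (induction A rule: finite_induct)
  case empty
  then show ?case by simp
next
  case (insert j A)
  from insert.IH obtain \<epsilon> :: "'a \<Rightarrow> nat" where
    \<epsilon>: "\<forall>\<beta> \<gamma>. (\<forall>i\<in>A. \<beta> i \<le> n) \<longrightarrow> (\<forall>i\<in>A. \<gamma> i \<le> n) \<longrightarrow>
      (\<Sum>i\<in>A. \<epsilon> i * \<beta> i) = (\<Sum>i\<in>A. \<epsilon> i * \<gamma> i) \<longrightarrow> (\<forall>i\<in>A. \<beta> i = \<gamma> i)"
    by (elim exE)
  define \<epsilon>' where "\<epsilon>' = (\<lambda>i. if i = j then 1 else Suc n * \<epsilon> i)"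
  have sum: "(\<Sum>i\<in>insert j A. \<epsilon>' i * \<beta> i) = \<beta> j + Suc n * (\<Sum>i\<in>A. \<epsilon> i * \<beta> i)" for \<beta>
  proof -
    have "(\<Sum>i\<in>A. \<epsilon>' i * \<beta> i) = (\<Sum>i\<in>A. Suc n * (\<epsilon> i * \<beta> i))"
      using insert.hyps by (intro sum.cong refl) (auto simp: \<epsilon>'_def mult.assoc simp del: mult_Suc)
    then show ?thesis using insert.hyps by (simp add: \<epsilon>'_def sum_distrib_left del: mult_Suc)
  qed
  show ?case
  proof (intro exI[of _ \<epsilon>'] allI impI)
    fix \<beta> \<gamma>
    assume le: "\<forall>i\<in>insert j A. \<beta> i \<le> n" "\<forall>i\<in>insert j A. \<gamma> i \<le> n"
      and eq: "(\<Sum>i\<in>insert j A. \<epsilon>' i * \<beta> i) = (\<Sum>i\<in>insert j A. \<epsilon>' i * \<gamma> i)"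
    define b c where "b = (\<Sum>i\<in>A. \<epsilon> i * \<beta> i)" and "c = (\<Sum>i\<in>A. \<epsilon> i * \<gamma> i)"
    have *: "\<beta> j + Suc n * b = \<gamma> j + Suc n * c" using eq by (simp only: sum b_def c_def)
    have lt: "\<beta> j < Suc n" "\<gamma> j < Suc n" using le by auto
    have "\<beta> j = \<gamma> j"
      using arg_cong[OF *, of "\<lambda>x. x mod Suc n"] lt by (simp del: mult_Suc)
    moreover have "b = c" using * calculation by (simp del: mult_Suc)
    moreover have "\<forall>i\<in>A. \<beta> i = \<gamma> i"
    proof -
      have "\<forall>i\<in>A. \<beta> i \<le> n" "\<forall>i\<in>A. \<gamma> i \<le> n" using le by simp_all
      then show ?thesis
        using \<epsilon>[THEN spec[of _ \<beta>], THEN spec[of _ \<gamma>]] \<open>b = c\<close> unfolding b_def c_def by simp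
    qed
    ultimately show "\<forall>i\<in>insert j A. \<beta> i = \<gamma> i" by simp
  qed
qed

text \<open>Weights \<open>m i = L + \<epsilon> i\<close> with \<open>L\<close> large compared to the digit weights \<open>\<epsilon> i\<close>. The common part \<open>L\<close> makes
  the weighted degree respect the bound \<open>n\<close> on the total degree, and the perturbation \<open>\<epsilon>\<close> separates
  the exponents below this bound.\<close>

lemma separating_grading:
  "\<exists>(L :: nat) m :: 'd :: finite \<Rightarrow> nat. L > 0 \<and> (\<forall>i. L \<le> m i) \<and>
     (\<forall>\<beta>. (\<Sum>i\<in>UNIV. \<beta> i) \<le> n \<longleftrightarrow> (\<Sum>i\<in>UNIV. m i * \<beta> i) < L * Suc n) \<and>
     inj_on (\<lambda>\<beta>. \<Sum>i\<in>UNIV. m i * \<beta> i) {\<beta>. (\<Sum>i\<in>UNIV. \<beta> i) \<le> n}"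
proof -
  obtain \<epsilon> :: "'d \<Rightarrow> nat" where
    \<epsilon>: "\<And>\<beta> \<gamma>. (\<forall>i. \<beta> i \<le> n) \<Longrightarrow> (\<forall>i. \<gamma> i \<le> n) \<Longrightarrow>
      (\<Sum>i\<in>UNIV. \<epsilon> i * \<beta> i) = (\<Sum>i\<in>UNIV. \<epsilon> i * \<gamma> i) \<Longrightarrow> \<beta> = \<gamma>"
    using digit_weights[OF finite[of UNIV], of n] by (simp only: ball_UNIV fun_eq_iff) blast
  define L where "L = Suc (n * sum \<epsilon> UNIV)"
  define m where "m = (\<lambda>i. L + \<epsilon> i)"
  define e where "e = (\<lambda>\<beta>. \<Sum>i\<in>UNIV. \<epsilon> i * \<beta> i)"
  have wt: "(\<Sum>i\<in>UNIV. m i * \<beta> i) = L * (\<Sum>i\<in>UNIV. \<beta> i) + e \<beta>" for \<beta>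
    by (simp add: m_def e_def add_mult_distrib sum.distrib sum_distrib_left)
  have le: "\<beta> i \<le> n" if "(\<Sum>i\<in>UNIV. \<beta> i) \<le> n" for \<beta> :: "'d \<Rightarrow> nat" and i
    using member_le_sum[of i UNIV \<beta>] that by simp
  have e: "e \<beta> < L" if "(\<Sum>i\<in>UNIV. \<beta> i) \<le> n" for \<beta>
  proof -
    have "e \<beta> \<le> (\<Sum>i\<in>UNIV. \<epsilon> i * n)"
      unfolding e_def by (intro sum_mono mult_left_mono le[OF that]) auto
    then show ?thesis by (simp add: L_def sum_distrib_left sum_distrib_right mult.commute)
  qed
  have lt: "L * (\<Sum>i\<in>UNIV. \<beta> i) + e \<beta> < L * Suc n" if "(\<Sum>i\<in>UNIV. \<beta> i) \<le> n" for \<beta>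
  proof -
    have "L * (\<Sum>i\<in>UNIV. \<beta> i) \<le> L * n" using that by (rule mult_le_mono2)
    then show ?thesis using e[OF that] by (simp only: mult_Suc_right)
  qed
  have "(\<Sum>i\<in>UNIV. \<beta> i) \<le> n" if "L * (\<Sum>i\<in>UNIV. \<beta> i) + e \<beta> < L * Suc n" for \<beta>
  proof -
    have "L * (\<Sum>i\<in>UNIV. \<beta> i) < L * Suc n" using that by linarith
    then show ?thesis by (simp del: mult_Suc_right)
  qed
  then have 1: "(\<Sum>i\<in>UNIV. \<beta> i) \<le> n \<longleftrightarrow> (\<Sum>i\<in>UNIV. m i * \<beta> i) < L * Suc n" for \<beta>
    unfolding wt using lt by blast
  have 2: "inj_on (\<lambda>\<beta>. \<Sum>i\<in>UNIV. m i * \<beta> i) {\<beta>. (\<Sum>i\<in>UNIV. \<beta> i) \<le> n}"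
  proof (rule inj_onI, unfold mem_Collect_eq wt)
    fix \<beta> \<gamma> :: "'d \<Rightarrow> nat"
    assume b: "(\<Sum>i\<in>UNIV. \<beta> i) \<le> n" and c: "(\<Sum>i\<in>UNIV. \<gamma> i) \<le> n"
      and eq: "L * (\<Sum>i\<in>UNIV. \<beta> i) + e \<beta> = L * (\<Sum>i\<in>UNIV. \<gamma> i) + e \<gamma>"
    have "e \<beta> = e \<gamma>"
      using arg_cong[OF eq, of "\<lambda>x. x mod L"] e[OF b] e[OF c] by simp
    then show "\<beta> = \<gamma>" using \<epsilon>[of \<beta> \<gamma>] le[OF b] le[OF c] by (simp add: e_def)
  qed
  show ?thesis using 1 2 by (intro exI[of _ L] exI[of _ m]) (auto simp: m_def L_def)
qed

lemma monomial_curve_tendsto_0: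
  fixes m :: "'d :: finite \<Rightarrow> nat"
  assumes "\<And>i. m i > 0"
  shows "filterlim (\<lambda>t. \<chi> i. complex_of_real (t ^ m i)) (at 0) (at_right (0::real))"
proof (rule filterlim_atI)
  have "((\<lambda>t. \<chi> i. complex_of_real (t ^ m i)) \<longlongrightarrow> (\<chi> i. of_real (0 ^ m i))) (at_right 0)"
    by (rule vec_tendstoI)
      (simp only: vec_lambda_beta, intro tendsto_of_real tendsto_power tendsto_ident_at)
  moreover have "(\<chi> i. complex_of_real (0 ^ m i)) = (0 :: complex ^ 'd)"
    using assms by (simp add: vec_eq_iff)
  ultimately show "((\<lambda>t. \<chi> i. complex_of_real (t ^ m i)) \<longlongrightarrow> 0) (at_right 0)" by simp
  show "\<forall>\<^sub>F t in at_right 0. (\<chi> i. complex_of_real (t ^ m i)) \<noteq> (0 :: complex ^ 'd)"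
    using eventually_at_right_less[of 0] by eventually_elim (auto simp: vec_eq_iff)
qed

text \<open>Along the curve \<open>z\<^sub>i = t ^ m i\<close> with the weights of \<open>separating_grading\<close>, distinct monomials of degree
  at most \<open>n\<close> become distinct powers of \<open>t\<close> below \<open>t ^ (L * Suc n)\<close>, and the monomials of higher degree
  become powers from \<open>t ^ (L * Suc n)\<close> on. If a low coefficient were nonzero, the monomial of least
  weight \<open>wt \<gamma>\<close> would dominate, and \<open>h\<close> would be of exact order \<open>t ^ wt \<gamma>\<close> on the curve. But
  \<open>norm z = O(t ^ L)\<close> there, so that \<open>h = O(t ^ (L * Suc n))\<close>.\<close>

lemma low_coeffs_of_vanishing_series:
  fixes h :: "complex ^ 'd \<Rightarrow> complex"
  assumes series: "has_power_series h a" and h: "h \<in> vanishing_order (Suc n)"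
    and \<beta>: "(\<Sum>i\<in>UNIV. \<beta> i) \<le> n"
  shows "a \<beta> = 0"
proof (rule ccontr)
  assume "a \<beta> \<noteq> 0"
  obtain L m where L: "L > 0" "\<And>i :: 'd. L \<le> m i"
    and low: "\<And>\<beta> :: 'd \<Rightarrow> nat. (\<Sum>i\<in>UNIV. \<beta> i) \<le> n \<longleftrightarrow> (\<Sum>i\<in>UNIV. m i * \<beta> i) < L * Suc n"
    and inj: "inj_on (\<lambda>\<beta>. \<Sum>i\<in>UNIV. m i * \<beta> i) {\<beta>. (\<Sum>i\<in>UNIV. \<beta> i) \<le> n}"
    using separating_grading[where 'd = 'd, of n] by blast
  define wt where "wt = (\<lambda>\<beta>. \<Sum>i\<in>UNIV. m i * \<beta> i)"
  define Z where "Z = (\<lambda>t. \<chi> i. complex_of_real (t ^ m i))"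
  obtain \<gamma> where \<gamma>: "a \<gamma> \<noteq> 0" "\<And>\<alpha>. a \<alpha> \<noteq> 0 \<Longrightarrow> wt \<gamma> \<le> wt \<alpha>"
    using ex_has_least_nat[of "\<lambda>\<alpha>. a \<alpha> \<noteq> 0" \<beta> wt] \<open>a \<beta> \<noteq> 0\<close> by blast
  have wt\<gamma>: "wt \<gamma> < L * Suc n" using \<gamma>(2)[OF \<open>a \<beta> \<noteq> 0\<close>] \<beta> low[of \<beta>] by (simp add: wt_def)
  have wt_less: "wt \<gamma> < wt \<alpha>" if "a \<alpha> \<noteq> 0" "\<alpha> \<noteq> \<gamma>" for \<alpha>
  proof (rule ccontr)
    assume "\<not> wt \<gamma> < wt \<alpha>"
    then have "wt \<alpha> = wt \<gamma>" using \<gamma>(2)[OF that(1)] by simp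
    then have "\<alpha> = \<gamma>"
      using wt\<gamma> low[of \<alpha>] low[of \<gamma>] inj by (auto simp: wt_def inj_on_def)
    then show False using that(2) by simp
  qed
  have m_pos: "m i > 0" for i using L(1) L(2)[of i] by simp
  have mono: "mono_power (Z t) \<alpha> = of_real (t ^ wt \<alpha>)" for t \<alpha>
    by (simp add: mono_power_def Z_def wt_def power_sum power_mult)
  have series_Z: "((\<lambda>\<alpha>. a \<alpha> * of_real (t ^ wt \<alpha>)) has_sum h (Z t)) UNIV" if "0 < t" "t < 1" for t
  proof -
    have "Z t \<in> polydisk"
      using that m_pos by (auto simp: polydisk_def Z_def norm_power power_less_one_iff)
    then have "((\<lambda>\<alpha>. a \<alpha> * mono_power (Z t) \<alpha>) has_sum h (Z t)) UNIV"
      using series unfolding has_power_series_def by blast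
    then show ?thesis by (simp only: mono)
  qed
  \<comment> \<open>Absolute convergence at the reference point \<open>t = 1/2\<close> bounds the tail for smaller \<open>t\<close>: all its
    exponents are at least \<open>Suc (wt \<gamma>)\<close>, so each term shrinks by the factor \<open>(2 * t) ^ Suc (wt \<gamma>)\<close>.\<close>
  define C where "C = (\<Sum>\<^sub>\<infinity>\<alpha>. norm (a \<alpha> * of_real ((1/2) ^ wt \<alpha>)))"
  have summable: "(\<lambda>\<alpha>. norm (a \<alpha> * of_real ((1/2) ^ wt \<alpha>))) summable_on UNIV"
    using has_sum_imp_summable[OF series_Z[of "1/2"]]
    by (simp flip: summable_on_iff_abs_summable_on_complex)
  have rest: "norm (h (Z t) - a \<gamma> * of_real (t ^ wt \<gamma>)) \<le> (2 * t) ^ Suc (wt \<gamma>) * C"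
    if t: "0 < t" "t \<le> 1/2" for t
  proof (rule norm_infsum_le)
    have "((\<lambda>\<alpha>. a \<alpha> * of_real (t ^ wt \<alpha>))
        has_sum (h (Z t) - a \<gamma> * of_real (t ^ wt \<gamma>))) (UNIV - {\<gamma>})"
      using t by (intro has_sum_Diff series_Z has_sum_finiteI) auto
    then show "((\<lambda>\<alpha>. if \<alpha> = \<gamma> then 0 else a \<alpha> * of_real (t ^ wt \<alpha>))
        has_sum (h (Z t) - a \<gamma> * of_real (t ^ wt \<gamma>))) UNIV"
      by (rule has_sum_cong_neutral[THEN iffD1, rotated -1]) auto
    show "((\<lambda>\<alpha>. (2 * t) ^ Suc (wt \<gamma>) * norm (a \<alpha> * of_real ((1/2) ^ wt \<alpha>)))
        has_sum (2 * t) ^ Suc (wt \<gamma>) * C) UNIV"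
      unfolding C_def by (intro has_sum_cmult_right has_sum_infsum summable)
    show "norm (if \<alpha> = \<gamma> then 0 else a \<alpha> * of_real (t ^ wt \<alpha>))
        \<le> (2 * t) ^ Suc (wt \<gamma>) * norm (a \<alpha> * of_real ((1/2) ^ wt \<alpha>))" for \<alpha>
    proof (cases "\<alpha> = \<gamma> \<or> a \<alpha> = 0")
      case True
      then show ?thesis using t by auto
    next
      case False
      then have "Suc (wt \<gamma>) \<le> wt \<alpha>" using wt_less by (simp add: Suc_le_eq)
      then have "(2 * t) ^ wt \<alpha> \<le> (2 * t) ^ Suc (wt \<gamma>)"
        using t by (intro power_decreasing) auto
      then have "t ^ wt \<alpha> \<le> (2 * t) ^ Suc (wt \<gamma>) * (1/2) ^ wt \<alpha>"
        by (simp add: power_mult_distrib field_simps)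
      then have "norm (a \<alpha>) * t ^ wt \<alpha> \<le> norm (a \<alpha>) * ((2 * t) ^ Suc (wt \<gamma>) * (1/2) ^ wt \<alpha>)"
        by (rule mult_left_mono) simp
      then show ?thesis using False t by (simp add: norm_mult norm_power mult_ac)
    qed
  qed
  obtain c where c: "c > 0" "\<forall>\<^sub>F z in at 0. norm (h z) \<le> c * norm (of_real (norm z ^ Suc n) :: complex)"
    using h unfolding vanishing_order_def by (auto elim!: landau_o.bigE)
  define d where "d = real CARD('d)"
  have norm_Z: "norm (Z t) \<le> d * t ^ L" if "0 < t" "t < 1" for t
  proof -
    have "norm (Z t) \<le> (\<Sum>i\<in>UNIV. norm (Z t $ i))"
      unfolding norm_vec_def by (rule L2_set_le_sum) simp
    also have "\<dots> \<le> (\<Sum>i\<in>(UNIV :: 'd set). t ^ L)"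
      using that L(2) by (intro sum_mono) (auto simp: Z_def norm_power intro: power_decreasing)
    finally show ?thesis by (simp add: d_def)
  qed
  have "\<forall>\<^sub>F t in at_right 0. norm (h (Z t)) \<le> c * norm (of_real (norm (Z t) ^ Suc n) :: complex)"
    using eventually_compose_filterlim[OF c(2) monomial_curve_tendsto_0[of m]] m_pos
    unfolding Z_def by blast
  moreover have "\<forall>\<^sub>F t :: real in at_right 0. t < 1/2"
    by (rule order_tendstoD[OF tendsto_ident_at]) simp
  ultimately have "\<forall>\<^sub>F t in at_right 0. norm (a \<gamma>) \<le> (2 ^ Suc (wt \<gamma>) * C + c * d ^ Suc n) * t"
    using eventually_at_right_less[of "0 :: real"]
  proof eventually_elim
    case (elim t)
    have "norm (h (Z t)) \<le> c * norm (Z t) ^ Suc n" using elim by (simp add: norm_power norm_mult)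
    also have "\<dots> \<le> c * (d * t ^ L) ^ Suc n"
      using norm_Z elim c(1) by (intro mult_left_mono power_mono) auto
    also have "\<dots> = c * d ^ Suc n * t ^ (L * Suc n)"
      by (simp only: power_mult_distrib power_mult mult.assoc)
    also have "\<dots> \<le> c * d ^ Suc n * t ^ Suc (wt \<gamma>)"
      using elim wt\<gamma> c(1) by (intro mult_left_mono power_decreasing) (auto simp: d_def)
    finally have 1: "norm (h (Z t)) \<le> c * d ^ Suc n * t ^ Suc (wt \<gamma>)" .
    have "norm (a \<gamma>) * t ^ wt \<gamma> = norm (a \<gamma> * of_real (t ^ wt \<gamma>))"
      using elim by (simp add: norm_mult norm_power)
    also have "\<dots> \<le> norm (h (Z t)) + norm (h (Z t) - a \<gamma> * of_real (t ^ wt \<gamma>))"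
      by norm
    also have "\<dots> \<le> c * d ^ Suc n * t ^ Suc (wt \<gamma>) + (2 * t) ^ Suc (wt \<gamma>) * C"
      using 1 rest[of t] elim by simp
    also have "\<dots> = (2 ^ Suc (wt \<gamma>) * C + c * d ^ Suc n) * t * t ^ wt \<gamma>"
      by (simp add: power_mult_distrib algebra_simps)
    finally show ?case using elim by simp
  qed
  moreover have "((\<lambda>t. (2 ^ Suc (wt \<gamma>) * C + c * d ^ Suc n) * t) \<longlongrightarrow> 0) (at_right 0)"
    by (rule tendsto_eq_intros refl | simp)+
  ultimately have "norm (a \<gamma>) \<le> 0" by (intro tendsto_lowerbound) auto
  then show False using \<gamma>(1) by simp
qed

section \<open>Coefficients in the Hardy space\<close>

text \<open>The zero function vanishes to every order, so all coefficients of the difference series are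
  zero.\<close>

lemma has_power_series_unique:
  fixes f :: "complex ^ 'd \<Rightarrow> complex"
  assumes "has_power_series f a" "has_power_series f b"
  shows "a = b"
proof
  fix \<beta>
  have "has_power_series (\<lambda>z. f z - f z) (\<lambda>\<alpha>. a \<alpha> - b \<alpha>)"
    unfolding has_power_series_def
  proof
    fix z :: "complex ^ 'd" assume "z \<in> polydisk"
    then have "((\<lambda>\<alpha>. a \<alpha> * mono_power z \<alpha> + - (b \<alpha> * mono_power z \<alpha>)) has_sum (f z + - f z)) UNIV"
      using assms unfolding has_power_series_def by (intro has_sum_add has_sum_uminusI) auto
    then show "((\<lambda>\<alpha>. (a \<alpha> - b \<alpha>) * mono_power z \<alpha>) has_sum (f z - f z)) UNIV"
      by (simp add: algebra_simps)
  qed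
  then have "has_power_series (\<lambda>z :: complex ^ 'd. 0) (\<lambda>\<alpha>. a \<alpha> - b \<alpha>)" by simp
  from low_coeffs_of_vanishing_series[OF this, of "\<Sum>i\<in>UNIV. \<beta> i" \<beta>]
  show "a \<beta> = b \<beta>" by (simp add: vanishing_order_def)
qed

lemma hardy_coeff_eqI: "has_power_series f a \<Longrightarrow> hardy_coeff f = a"
  unfolding hardy_coeff_def by (rule the_equality) (auto intro: has_power_series_unique)

lemma hardy2_has_power_series:
  assumes "f \<in> hardy2"
  shows "has_power_series f (hardy_coeff f)"
    and "(\<lambda>\<alpha>. (cmod (hardy_coeff f \<alpha>))\<^sup>2) summable_on UNIV"
  using assms by (auto simp: hardy2_def dest: hardy_coeff_eqI)

lemma has_power_series_add:
  assumes "has_power_series f a" "has_power_series g b"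
  shows "has_power_series (f + g) (\<lambda>\<alpha>. a \<alpha> + b \<alpha>)"
  using assms unfolding has_power_series_def
  by (auto simp: distrib_right plus_fun_def intro!: has_sum_add)

lemma has_power_series_scale:
  assumes "has_power_series f a"
  shows "has_power_series (cscale c f) (\<lambda>\<alpha>. c * a \<alpha>)"
  using assms unfolding has_power_series_def
  by (auto simp: mult.assoc cscale_def intro!: has_sum_cmult_right)

lemma mv_holomorphic_on_const: "(\<lambda>_. c) mv_holomorphic_on S"
  unfolding mv_holomorphic_on_def by (intro ballI exI[of _ "\<lambda>_. 0"]) auto

lemma mv_holomorphic_on_add:
  assumes "f mv_holomorphic_on S" "g mv_holomorphic_on S"
  shows "(f + g) mv_holomorphic_on S"
  unfolding mv_holomorphic_on_def
proof
  fix z assume "z \<in> S"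
  then obtain D E where "(f has_derivative D) (at z)" "\<forall>c v. D (c *s v) = c * D v"
    "(g has_derivative E) (at z)" "\<forall>c v. E (c *s v) = c * E v"
    using assms unfolding mv_holomorphic_on_def by blast
  then show "\<exists>D. ((f + g) has_derivative D) (at z) \<and> (\<forall>c v. D (c *s v) = c * D v)"
    unfolding plus_fun_def
    by (intro exI[of _ "\<lambda>v. D v + E v"]) (auto intro: has_derivative_add simp: algebra_simps)
qed

lemma mv_holomorphic_on_mult:
  assumes "f mv_holomorphic_on S" "g mv_holomorphic_on S"
  shows "(\<lambda>z. f z * g z) mv_holomorphic_on S"
  unfolding mv_holomorphic_on_def
proof
  fix z assume "z \<in> S"
  then obtain D E where "(f has_derivative D) (at z)" "\<forall>c v. D (c *s v) = c * D v"
    "(g has_derivative E) (at z)" "\<forall>c v. E (c *s v) = c * E v"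
    using assms unfolding mv_holomorphic_on_def by blast
  then show "\<exists>D. ((\<lambda>z. f z * g z) has_derivative D) (at z) \<and> (\<forall>c v. D (c *s v) = c * D v)"
    by (intro exI[of _ "\<lambda>v. f z * E v + D v * g z"] conjI has_derivative_mult)
      (auto simp: algebra_simps)
qed

lemma mv_holomorphic_on_coordinate: "(\<lambda>z. z $ i) mv_holomorphic_on S"
  unfolding mv_holomorphic_on_def
  by (intro ballI exI[of _ "\<lambda>z. z $ i"])
    (auto intro: bounded_linear_imp_has_derivative bounded_linear_vec_nth)

lemma mv_holomorphic_on_power:
  "f mv_holomorphic_on S \<Longrightarrow> (\<lambda>z. f z ^ k) mv_holomorphic_on S"
  by (induction k) (simp_all add: mv_holomorphic_on_const mv_holomorphic_on_mult)

lemma mv_holomorphic_on_prod: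
  assumes "finite I" "\<And>i. i \<in> I \<Longrightarrow> f i mv_holomorphic_on S"
  shows "(\<lambda>z. \<Prod>i\<in>I. f i z) mv_holomorphic_on S"
  using assms
  by (induction I rule: finite_induct) (simp_all add: mv_holomorphic_on_const mv_holomorphic_on_mult)

lemma mv_holomorphic_on_cong_open:
  assumes "f mv_holomorphic_on S" "open S" "\<And>z. z \<in> S \<Longrightarrow> f z = g z"
  shows "g mv_holomorphic_on S"
  using assms unfolding mv_holomorphic_on_def
  by (meson has_derivative_transform_within_open)

lemma open_polydisk: "open (polydisk :: (complex ^ 'd) set)"
proof -
  have "polydisk = (\<Inter>i. {z :: complex ^ 'd. cmod (z $ i) < 1})" by (auto simp: polydisk_def)
  also have "open \<dots>" by (intro open_INT ballI open_Collect_less continuous_intros) auto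
  finally show ?thesis .
qed

lemma subspace_hardy2: "cfun.subspace (hardy2 :: (complex ^ 'd \<Rightarrow> complex) set)"
  unfolding cfun.subspace_def
proof (intro conjI ballI allI)
  have "has_power_series (0 :: complex ^ 'd \<Rightarrow> complex) (\<lambda>_. 0)"
    by (simp add: has_power_series_def)
  then show "(0 :: complex ^ 'd \<Rightarrow> complex) \<in> hardy2"
    using mv_holomorphic_on_const[of 0 polydisk]
    by (auto simp: hardy2_def zero_fun_def intro!: exI[of _ "\<lambda>_. 0"])
next
  fix f g :: "complex ^ 'd \<Rightarrow> complex" assume fg: "f \<in> hardy2" "g \<in> hardy2"
  define a b where "a = hardy_coeff f" and "b = hardy_coeff g"
  have series: "has_power_series (f + g) (\<lambda>\<alpha>. a \<alpha> + b \<alpha>)"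
    unfolding a_def b_def by (intro has_power_series_add hardy2_has_power_series fg)
  have "(\<lambda>\<alpha>. 2 * (cmod (a \<alpha>))\<^sup>2 + 2 * (cmod (b \<alpha>))\<^sup>2) summable_on UNIV"
    unfolding a_def b_def by (intro summable_on_add summable_on_cmult_right hardy2_has_power_series fg)
  then have "(\<lambda>\<alpha>. (cmod (a \<alpha> + b \<alpha>))\<^sup>2) summable_on UNIV"
  proof (rule summable_on_comparison_test)
    fix \<alpha>
    have "(cmod (a \<alpha> + b \<alpha>))\<^sup>2 \<le> (cmod (a \<alpha>) + cmod (b \<alpha>))\<^sup>2"
      by (intro power_mono norm_triangle_ineq) simp
    also have "\<dots> \<le> 2 * (cmod (a \<alpha>))\<^sup>2 + 2 * (cmod (b \<alpha>))\<^sup>2"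
      using sum_squares_bound[of "cmod (a \<alpha>)" "cmod (b \<alpha>)"] by (simp add: power2_sum)
    finally show "(cmod (a \<alpha> + b \<alpha>))\<^sup>2 \<le> 2 * (cmod (a \<alpha>))\<^sup>2 + 2 * (cmod (b \<alpha>))\<^sup>2" .
  qed simp
  then show "f + g \<in> hardy2"
    using fg series by (auto simp: hardy2_def intro: mv_holomorphic_on_add)
next
  fix c and f :: "complex ^ 'd \<Rightarrow> complex" assume f: "f \<in> hardy2"
  have "(\<lambda>\<alpha>. (cmod c)\<^sup>2 * (cmod (hardy_coeff f \<alpha>))\<^sup>2) summable_on UNIV"
    by (intro summable_on_cmult_right hardy2_has_power_series f)
  then show "cscale c f \<in> hardy2"
    using f has_power_series_scale[OF hardy2_has_power_series(1)[OF f], of c]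
      mv_holomorphic_on_mult[OF mv_holomorphic_on_const[of c], of f polydisk]
    by (auto simp: hardy2_def cscale_def norm_mult power_mult_distrib)
qed

lemma hardy_coeff_add:
  "f \<in> hardy2 \<Longrightarrow> g \<in> hardy2 \<Longrightarrow> hardy_coeff (f + g) \<alpha> = hardy_coeff f \<alpha> + hardy_coeff g \<alpha>"
  using hardy_coeff_eqI[OF has_power_series_add] hardy2_has_power_series(1) by metis

lemma hardy_coeff_scale:
  "f \<in> hardy2 \<Longrightarrow> hardy_coeff (cscale c f) \<alpha> = c * hardy_coeff f \<alpha>"
  using hardy_coeff_eqI[OF has_power_series_scale] hardy2_has_power_series(1) by metis

lemma norm_hardy_coeff_le:
  assumes "f \<in> hardy2"
  shows "cmod (hardy_coeff f \<alpha>) \<le> hardy_norm f"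
proof -
  have "(\<Sum>\<alpha>\<in>{\<alpha>}. (cmod (hardy_coeff f \<alpha>))\<^sup>2) \<le> (\<Sum>\<^sub>\<infinity>\<alpha>. (cmod (hardy_coeff f \<alpha>))\<^sup>2)"
    by (rule finite_sum_le_infsum[OF hardy2_has_power_series(2)[OF assms]]) auto
  then show ?thesis unfolding hardy_norm_def by (intro real_le_rsqrt) simp
qed

lemma hardy2_monomial:
  fixes \<beta> :: "'d :: finite \<Rightarrow> nat"
  defines "e \<equiv> \<lambda>z. if z \<in> polydisk then mono_power z \<beta> else 0"
  shows "e \<in> hardy2" and "hardy_coeff e = (\<lambda>\<alpha>. if \<alpha> = \<beta> then 1 else 0)"
proof -
  define a where "a = (\<lambda>\<alpha>. if \<alpha> = \<beta> then 1 else 0 :: complex)"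
  have series: "has_power_series e a"
    unfolding has_power_series_def
  proof
    fix z :: "complex ^ 'd" assume "z \<in> polydisk"
    then show "((\<lambda>\<alpha>. a \<alpha> * mono_power z \<alpha>) has_sum e z) UNIV"
      by (intro has_sum_finite_neutralI[of "{\<beta>}"]) (auto simp: a_def e_def)
  qed
  then show "hardy_coeff e = (\<lambda>\<alpha>. if \<alpha> = \<beta> then 1 else 0)"
    by (simp add: hardy_coeff_eqI a_def)
  have "(\<lambda>z. mono_power z \<beta>) mv_holomorphic_on polydisk"
    unfolding mono_power_def
    by (intro mv_holomorphic_on_prod mv_holomorphic_on_power mv_holomorphic_on_coordinate) auto
  then have "e mv_holomorphic_on polydisk"
    by (rule mv_holomorphic_on_cong_open[OF _ open_polydisk]) (simp add: e_def)
  moreover have "(\<lambda>\<alpha>. (cmod (a \<alpha>))\<^sup>2) summable_on UNIV"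
    by (rule has_sum_imp_summable[OF has_sum_finite_neutralI[of "{\<beta>}"]]) (auto simp: a_def)
  ultimately show "e \<in> hardy2" using series by (auto simp: hardy2_def e_def)
qed

section \<open>The finitely generated module modulo functions of high vanishing order\<close>

text \<open>The span of all \<open>\<psi>\<^sup>\<gamma> h\<close> is stable under multiplication by each \<open>\<psi> i\<close>, hence also by \<open>\<psi> i + c i\<close>.
  With \<open>\<psi> i = \<phi> i - \<phi> i 0\<close> and \<open>c i = \<phi> i 0\<close> this turns the generators of the module into combinations
  of products of functions that vanish at the origin.\<close>

lemma span_power_products_translate:
  fixes \<psi> :: "'i \<Rightarrow> 'a \<Rightarrow> complex"
  assumes I: "finite I" and h: "h \<in> H"
  shows "(\<lambda>z. (\<Prod>i\<in>I. (\<psi> i z + c i) ^ \<alpha> i) * h z)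
    \<in> cfun.span {(\<lambda>z. (\<Prod>i\<in>I. \<psi> i z ^ \<gamma> i) * h z) | \<gamma> h. h \<in> H}" (is "_ \<in> cfun.span ?G")
proof -
  have mult: "(\<lambda>z. \<psi> i z * g z) \<in> cfun.span ?G" if i: "i \<in> I" and g: "g \<in> cfun.span ?G" for i g
    using g
  proof (induction rule: cfun.span_induct_alt)
    case base
    then show ?case using cfun.span_zero by (simp add: zero_fun_def)
  next
    case (step k g g')
    then obtain \<gamma> h where g: "g = (\<lambda>z. (\<Prod>i\<in>I. \<psi> i z ^ \<gamma> i) * h z)" "h \<in> H" by blast
    have "(\<Prod>j\<in>I. \<psi> j z ^ (\<gamma>(i := Suc (\<gamma> i))) j) = \<psi> i z * (\<Prod>j\<in>I. \<psi> j z ^ \<gamma> j)" for z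
      using I i by (simp add: prod.remove[of I i])
    then have "(\<lambda>z. \<psi> i z * g z) = (\<lambda>z. (\<Prod>j\<in>I. \<psi> j z ^ (\<gamma>(i := Suc (\<gamma> i))) j) * h z)"
      by (simp add: g fun_eq_iff)
    also have "\<dots> \<in> ?G" using g(2) by blast
    finally have "cscale k (\<lambda>z. \<psi> i z * g z) + (\<lambda>z. \<psi> i z * g' z) \<in> cfun.span ?G"
      using step.IH by (intro cfun.span_add cfun.span_scale) (auto intro: cfun.span_base)
    also have "cscale k (\<lambda>z. \<psi> i z * g z) + (\<lambda>z. \<psi> i z * g' z) = (\<lambda>z. \<psi> i z * (cscale k g + g') z)"
      by (simp add: fun_eq_iff cscale_def algebra_simps)
    finally show ?case .
  qed
  have mult_power: "(\<lambda>z. (\<psi> i z + c i) ^ k * g z) \<in> cfun.span ?G"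
    if i: "i \<in> I" and g: "g \<in> cfun.span ?G" for i g k
  proof (induction k)
    case 0
    then show ?case using g by simp
  next
    case (Suc k)
    have "(\<lambda>z. \<psi> i z * ((\<psi> i z + c i) ^ k * g z)) + cscale (c i) (\<lambda>z. (\<psi> i z + c i) ^ k * g z)
        \<in> cfun.span ?G"
      using Suc i by (intro cfun.span_add cfun.span_scale mult)
    also have "(\<lambda>z. \<psi> i z * ((\<psi> i z + c i) ^ k * g z)) + cscale (c i) (\<lambda>z. (\<psi> i z + c i) ^ k * g z)
        = (\<lambda>z. (\<psi> i z + c i) ^ Suc k * g z)"
      by (simp add: fun_eq_iff cscale_def algebra_simps)
    finally show ?case .
  qed
  have "(\<lambda>z. (\<Prod>i\<in>J. (\<psi> i z + c i) ^ \<alpha> i) * h z) \<in> cfun.span ?G" if "J \<subseteq> I" for J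
    using finite_subset[OF that I] that
  proof (induction J rule: finite_induct)
    case empty
    have "h \<in> ?G" using h by (intro CollectI exI[of _ "\<lambda>_. 0"] exI[of _ h]) simp
    then show ?case by (simp add: cfun.span_base)
  next
    case (insert j J)
    then have "(\<lambda>z. (\<psi> j z + c j) ^ \<alpha> j * ((\<Prod>i\<in>J. (\<psi> i z + c i) ^ \<alpha> i) * h z)) \<in> cfun.span ?G"
      by (intro mult_power) auto
    then show ?case using insert.hyps by (simp add: mult.assoc)
  qed
  then show ?thesis by blast
qed

lemma card_functions_le: "card {\<beta> :: 'd :: finite \<Rightarrow> nat. \<forall>i. \<beta> i \<le> k} = Suc k ^ CARD('d)"
proof -
  have "{\<beta> :: 'd \<Rightarrow> nat. \<forall>i. \<beta> i \<le> k} = (UNIV :: 'd set) \<rightarrow>\<^sub>E {..k}" by (auto simp: PiE_def Pi_def)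
  then show ?thesis by (simp add: card_PiE)
qed

lemma finite_functions_le: "finite {\<beta> :: 'd :: finite \<Rightarrow> nat. \<forall>i. \<beta> i \<le> k}"
  by (rule card_ge_0_finite) (simp add: card_functions_le)

text \<open>A product \<open>\<psi>\<^sup>\<gamma> f j\<close> with \<open>\<psi> i = \<phi> i - \<phi> i 0\<close> vanishes to the order \<open>|\<gamma>|\<close>, so only the exponents
  with \<open>|\<gamma>| \<le> n\<close> matter. They are counted crudely by the box \<open>{..n} ^ q\<close> that contains them; this
  has the right order of growth in \<open>n\<close>.\<close>

lemma module_generators_modulo_vanishing_order:
  fixes \<phi> f :: "nat \<Rightarrow> complex ^ 'd \<Rightarrow> complex"
  assumes \<phi>: "\<And>i. i \<in> {1..q} \<Longrightarrow> (\<lambda>z. \<phi> i z - \<phi> i 0) \<in> vanishing_order 1"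
    and f: "\<And>j. j \<in> {1..r} \<Longrightarrow> f j \<in> vanishing_order 0"
  shows "\<exists>U. finite U \<and> card U \<le> r * Suc n ^ q \<and>
    cfun.span {(\<lambda>z. (\<Prod>i=1..q. \<phi> i z ^ \<alpha> i) * f j z) | (\<alpha> :: nat \<Rightarrow> nat) j. j \<in> {1..r}}
      \<subseteq> cfun.span (U \<union> vanishing_order (Suc n))"
proof -
  define \<psi> where "\<psi> = (\<lambda>i z. \<phi> i z - \<phi> i 0)"
  define p where "p = (\<lambda>(\<gamma> :: nat \<Rightarrow> nat, j) z. (\<Prod>i=1..q. \<psi> i z ^ \<gamma> i) * f j z)"
  define E where "E = ({1..q} \<rightarrow>\<^sub>E {..n}) \<times> {1..r}"
  define U where "U = p ` E"
  have E: "finite E" "card E = r * Suc n ^ q"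
    by (auto simp: E_def card_PiE finite_PiE card_cartesian_product)
  have U: "finite U" "card U \<le> r * Suc n ^ q"
    using E card_image_le[of E p] by (auto simp: U_def)
  have p: "p (\<gamma>, j) \<in> U \<union> vanishing_order (Suc n)" if j: "j \<in> {1..r}" for \<gamma> j
  proof (cases "(\<Sum>i=1..q. \<gamma> i) \<le> n")
    case True
    have "\<gamma> i \<le> n" if "i \<in> {1..q}" for i
      using member_le_sum[of i "{1..q}" \<gamma>] that True by simp
    then have "(restrict \<gamma> {1..q}, j) \<in> E" using j by (auto simp: E_def)
    moreover have "p (\<gamma>, j) = p (restrict \<gamma> {1..q}, j)"
      by (auto simp: p_def fun_eq_iff intro!: prod.cong)
    ultimately show ?thesis unfolding U_def by blast
  next
    case False
    have "(\<lambda>z. (\<Prod>i=1..q. \<psi> i z ^ \<gamma> i) * f j z) \<in> vanishing_order ((\<Sum>i=1..q. \<gamma> i) + 0)"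
      using \<phi> f[OF j] by (intro vanishing_order_mult vanishing_order_prod_power) (auto simp: \<psi>_def)
    then have "p (\<gamma>, j) \<in> vanishing_order (\<Sum>i=1..q. \<gamma> i)" by (simp add: p_def)
    then show ?thesis using False vanishing_order_antimono[of "Suc n" "\<Sum>i=1..q. \<gamma> i"] by auto
  qed
  have "(\<lambda>z. (\<Prod>i=1..q. \<phi> i z ^ \<alpha> i) * f j z) \<in> cfun.span (U \<union> vanishing_order (Suc n))"
    if j: "j \<in> {1..r}" for \<alpha> j
  proof -
    have "(\<lambda>z. (\<Prod>i=1..q. (\<psi> i z + \<phi> i 0) ^ \<alpha> i) * f j z)
        \<in> cfun.span {(\<lambda>z. (\<Prod>i=1..q. \<psi> i z ^ \<gamma> i) * h z) | \<gamma> h. h \<in> f ` {1..r}}"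
      using j by (intro span_power_products_translate) auto
    also have "\<dots> \<subseteq> cfun.span (U \<union> vanishing_order (Suc n))"
      using p unfolding p_def by (intro cfun.span_mono) fastforce
    finally show ?thesis by (simp add: \<psi>_def)
  qed
  then have "cfun.span {(\<lambda>z. (\<Prod>i=1..q. \<phi> i z ^ \<alpha> i) * f j z) | (\<alpha> :: nat \<Rightarrow> nat) j. j \<in> {1..r}}
      \<subseteq> cfun.span (U \<union> vanishing_order (Suc n))"
    by (intro cfun.span_minimal cfun.subspace_span) auto
  then show ?thesis using U by blast
qed

text \<open>Both counts are made with boxes. The exponents with all \<open>d\<close> entries at most \<open>k\<close> have degree at
  most \<open>n = d * k\<close> and number \<open>Suc k ^ d\<close>, and the left side is the bound on the number of equations
  for this \<open>n\<close>: generators of the module, and \<open>m\<close> coset representatives.\<close>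

lemma exists_degree_exceeding:
  fixes q d r m :: nat
  assumes "q < d"
  shows "\<exists>k. r * Suc (d * k) ^ q + m < Suc k ^ d"
proof -
  define k where "k = r * d ^ q + m"
  have "r * Suc (d * k) ^ q \<le> r * (d * Suc k) ^ q"
    using assms by (intro mult_le_mono2 power_mono) auto
  then have "r * Suc (d * k) ^ q + m \<le> (r * d ^ q) * Suc k ^ q + m * Suc k ^ q"
    by (intro add_mono) (auto simp: power_mult_distrib simp del: mult_Suc_right power_Suc)
  also have "\<dots> = k * Suc k ^ q" by (simp add: k_def algebra_simps)
  also have "\<dots> < Suc k ^ Suc q" by simp
  also have "\<dots> \<le> Suc k ^ d" using assms by (intro power_increasing) auto
  finally show ?thesis by blast
qed

section \<open>Infinite codimension\<close>

theorem theorem2p2: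
  fixes \<phi> :: "nat \<Rightarrow> complex ^ 'd \<Rightarrow> complex"
    and f :: "nat \<Rightarrow> complex ^ 'd \<Rightarrow> complex"
    and q r :: nat
  assumes "1 \<le> q" and "q < CARD('d)" and "1 \<le> r"
    and "\<And>i. i \<in> {1..q} \<Longrightarrow> \<phi> i \<in> hardy_inf"
    and "\<And>j. j \<in> {1..r} \<Longrightarrow> f j \<in> hardy2"
  shows "infinite_codim hardy2 (hardy_module q r \<phi> f)"
proof (rule ccontr)
  assume contra: "\<not> infinite_codim hardy2 (hardy_module q r \<phi> f)"
  define S where "S = cfun.span
    {(\<lambda>z. (\<Prod>i=1..q. \<phi> i z ^ \<alpha> i) * f j z) | (\<alpha> :: nat \<Rightarrow> nat) j. j \<in> {1..r}}"
  have M: "hardy_module q r \<phi> f = hardy_closure S" by (simp add: hardy_module_def S_def)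
  note hardy2_0 = cfun.subspace_0[OF subspace_hardy2] and hardy2_diff = cfun.subspace_diff[OF subspace_hardy2]
    and hardy2_add = cfun.subspace_add[OF subspace_hardy2]
    and hardy2_scale = cfun.subspace_scale[OF subspace_hardy2]
  have coeff_0: "hardy_coeff 0 \<alpha> = 0" for \<alpha> :: "'d \<Rightarrow> nat"
    using hardy_coeff_scale[OF hardy2_0, of 0 \<alpha>] by (simp add: cscale_def zero_fun_def)
  have "0 \<in> hardy_closure S"
    using hardy2_0 by (auto simp: hardy_closure_def hardy_norm_def coeff_0 S_def cfun.span_zero
        intro!: bexI[of _ 0])
  then obtain W' where W': "W' \<subseteq> hardy2" "finite W'"
    "\<And>P. cfun.subspace P \<Longrightarrow> hardy_closure S \<subseteq> P \<Longrightarrow> W' \<subseteq> P \<Longrightarrow> hardy2 \<subseteq> P"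
    using not_infinite_codim_imp_finitely_generated[OF contra] unfolding M by blast

  obtain k where k: "r * Suc (CARD('d) * k) ^ q + card W' < Suc k ^ CARD('d)"
    using exists_degree_exceeding[OF assms(2)] by blast
  define n where "n = CARD('d) * k"
  define B where "B = {\<beta> :: 'd \<Rightarrow> nat. \<forall>i. \<beta> i \<le> k}"
  have B: "finite B" "card B = Suc k ^ CARD('d)"
    by (simp_all add: B_def finite_functions_le card_functions_le)
  have B_le: "(\<Sum>i\<in>UNIV. \<beta> i) \<le> n" if "\<beta> \<in> B" for \<beta>
    using sum_bounded_above[of UNIV \<beta> k] that by (simp add: B_def n_def)

  obtain U where U: "finite U" "card U \<le> r * Suc n ^ q" "S \<subseteq> cfun.span (U \<union> vanishing_order (Suc n))"
  proof -
    have "(\<lambda>z. \<phi> i z - \<phi> i 0) \<in> vanishing_order 1" if "i \<in> {1..q}" for i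
      using assms(4)[OF that] by (intro mv_holomorphic_on_imp_vanishing_order_1) (auto simp: hardy_inf_def)
    moreover have "f j \<in> vanishing_order 0" if "j \<in> {1..r}" for j
      using assms(5)[OF that] by (intro mv_holomorphic_on_imp_vanishing_order_0) (auto simp: hardy2_def)
    ultimately show ?thesis
      using module_generators_modulo_vanishing_order[of q \<phi> r f n] that unfolding S_def by blast
  qed
  obtain W where W: "W \<subseteq> hardy2" "finite W" "card W \<le> card U"
    "hardy2 \<inter> cfun.span (U \<union> vanishing_order (Suc n)) \<subseteq> cfun.span (W \<union> vanishing_order (Suc n))"
    using cfun.subspace_Int_span_Un_le[OF subspace_hardy2 U(1)] by blast

  \<comment> \<open>The unknowns are the coefficients of \<open>\<Lambda>\<close>, one for each exponent in \<open>B\<close>; the equations are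
    indexed by the generators in \<open>W\<close> and the coset representatives in \<open>W'\<close>.\<close>
  have "card (W \<union> W') < card B"
    using card_Un_le[of W W'] W(3) U(2) k B(2) by (simp add: n_def)
  then obtain x where x: "\<exists>\<beta>\<in>B. x \<beta> \<noteq> 0" "\<And>w. w \<in> W \<union> W' \<Longrightarrow> (\<Sum>\<beta>\<in>B. hardy_coeff w \<beta> * x \<beta>) = 0"
    using homogeneous_system_nontrivial_solution[of "W \<union> W'" B hardy_coeff] W(2) W'(2) B(1) by blast
  define \<Lambda> where "\<Lambda> = (\<lambda>h. \<Sum>\<beta>\<in>B. hardy_coeff h \<beta> * x \<beta>)"
  have \<Lambda>_add: "\<Lambda> (g + h) = \<Lambda> g + \<Lambda> h" if "g \<in> hardy2" "h \<in> hardy2" for g h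
    using that by (simp add: \<Lambda>_def hardy_coeff_add distrib_right sum.distrib)
  have \<Lambda>_scale: "\<Lambda> (cscale c h) = c * \<Lambda> h" if "h \<in> hardy2" for c h
    using that by (simp add: \<Lambda>_def hardy_coeff_scale sum_distrib_left mult.assoc)
  \<comment> \<open>The rest of the proof shows that the kernel of \<open>\<Lambda>\<close> is all of \<open>hardy2\<close>.\<close>
  define P where "P = {h \<in> hardy2. \<Lambda> h = 0}"
  have P: "cfun.subspace P"
    unfolding cfun.subspace_def P_def
    using hardy2_0 hardy2_add hardy2_scale \<Lambda>_add \<Lambda>_scale by (auto simp: \<Lambda>_def coeff_0)
  have W_P: "W \<union> W' \<subseteq> P" using W(1) W'(1) x(2) by (auto simp: P_def \<Lambda>_def)
  have vanish_P: "h \<in> P" if "h \<in> hardy2" "h \<in> vanishing_order (Suc n)" for h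
    using low_coeffs_of_vanishing_series[OF hardy2_has_power_series(1) that(2)] B_le that
    by (auto simp: P_def \<Lambda>_def intro!: sum.neutral)
  have S_P: "S \<inter> hardy2 \<subseteq> P"
  proof
    fix s assume "s \<in> S \<inter> hardy2"
    then have s: "s \<in> hardy2" "s \<in> cfun.span (W \<union> vanishing_order (Suc n))" using U(3) W(4) by auto
    then obtain w v where wv: "s = w + v" "w \<in> cfun.span W" "v \<in> vanishing_order (Suc n)"
      unfolding cfun.span_Un cfun.span_eq_iff[THEN iffD2, OF subspace_vanishing_order] by blast
    have w: "w \<in> P" using wv(2) cfun.span_minimal[OF _ P, of W] W_P by auto
    \<comment> \<open>The error term \<open>v\<close> lies in \<open>hardy2\<close>, since \<open>w\<close> was chosen there.\<close>
    have "v = s - w" using wv(1) by simp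
    then have "v \<in> hardy2" using s(1) w hardy2_diff by (auto simp: P_def)
    then show "s \<in> P" using wv w vanish_P cfun.subspace_add[OF P] by auto
  qed
  have closure_P: "hardy_closure S \<subseteq> P"
  proof
    fix g assume g: "g \<in> hardy_closure S"
    then have g2: "g \<in> hardy2" by (simp add: hardy_closure_def)
    define C where "C = (\<Sum>\<beta>\<in>B. cmod (x \<beta>))"
    have C: "C \<ge> 0" by (simp add: C_def sum_nonneg)
    have "cmod (\<Lambda> g) \<le> 0 + e" if e: "e > 0" for e
    proof -
      have "e / (C + 1) > 0" using e C by simp
      then obtain h where h: "h \<in> S \<inter> hardy2" "hardy_norm (g - h) < e / (C + 1)"
        using g unfolding hardy_closure_def by blast
      have gh: "g - h \<in> hardy2" using g2 h(1) hardy2_diff by auto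
      have "\<Lambda> g = \<Lambda> ((g - h) + h)" by simp
      also have "\<dots> = \<Lambda> (g - h) + \<Lambda> h" using gh h(1) by (intro \<Lambda>_add) auto
      also have "\<Lambda> h = 0" using S_P h(1) by (auto simp: P_def)
      finally have eq: "\<Lambda> g = \<Lambda> (g - h)" by (simp only: add_0_right)
      have "cmod (\<Lambda> g) \<le> (\<Sum>\<beta>\<in>B. cmod (hardy_coeff (g - h) \<beta> * x \<beta>))"
        unfolding eq unfolding \<Lambda>_def by (rule norm_sum)
      also have "\<dots> \<le> (\<Sum>\<beta>\<in>B. e / (C + 1) * cmod (x \<beta>))"
      proof (rule sum_mono)
        fix \<beta>
        have "cmod (hardy_coeff (g - h) \<beta>) \<le> e / (C + 1)"
          using norm_hardy_coeff_le[OF gh, of \<beta>] h(2) by simp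
        then show "cmod (hardy_coeff (g - h) \<beta> * x \<beta>) \<le> e / (C + 1) * cmod (x \<beta>)"
          by (simp only: norm_mult mult_right_mono norm_ge_zero)
      qed
      also have "\<dots> = e / (C + 1) * C" by (simp add: C_def sum_distrib_left)
      also have "\<dots> \<le> e" using C e by (simp add: field_simps)
      finally show ?thesis by simp
    qed
    then have "cmod (\<Lambda> g) \<le> 0" by (rule field_le_epsilon)
    then show "g \<in> P" using g2 by (simp add: P_def)
  qed
  have all_P: "hardy2 \<subseteq> P" using W'(3)[OF P closure_P] W_P by auto
  obtain \<beta> where \<beta>: "\<beta> \<in> B" "x \<beta> \<noteq> 0" using x(1) by blast
  have "\<Lambda> (\<lambda>z. if z \<in> polydisk then mono_power z \<beta> else 0) = (\<Sum>\<alpha>\<in>B. if \<alpha> = \<beta> then x \<alpha> else 0)"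
    unfolding \<Lambda>_def hardy2_monomial(2) by (intro sum.cong) auto
  also have "\<dots> = x \<beta>" using \<beta>(1) B(1) by simp
  finally have "x \<beta> = 0" using hardy2_monomial(1)[of \<beta>] all_P by (auto simp: P_def)
  then show False using \<beta>(2) by simp
qed

end
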